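(* Let $\mathbb{F}$ be a field with $\operatorname{char}(\mathbb{F}) = 0$ and let $P \in \mathbb{F}[x_1,\ldots,x_n]$ be a homogeneous polynomial. If $\phi, \psi \colon \mathbb{F}^n \to \mathbb{F}^n$ are maps such that $$P(\mathbf{x} + \lambda \mathbf{y}) = P(\phi(\mathbf{x}) + \lambda \psi(\mathbf{y}))\quad\text{for all } \mathbf{x},\mathbf{y} \in \mathbb{F}^n,\ \lambda \in \mathbb{F},$$ then there exists a unique linear map $T_{\operatorname{rad}(P)} \colon \mathbb{F}^n/\operatorname{rad}(P) \to \mathbb{F}^n/\operatorname{rad}(P)$ preserving $P_{\operatorname{rad}(P)}$ such that $$\pi_{\operatorname{rad}(P)} \circ \phi = \pi_{\operatorname{rad}(P)} \circ \psi = T_{\operatorname{rad}(P)} \circ \pi_{\operatorname{rad}(P)}.$$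
   Context: For a polynomial $P \in \mathbb{F}[x_1,\ldots,x_n]$, regarded as a function $\mathbb{F}^n\to\mathbb{F}$, the radical of $P$ is the vector subspace $\operatorname{rad}(P) = \{\mathbf{x} \in \mathbb{F}^n \mid P(\mathbf{a} + \lambda \mathbf{x}) = P(\mathbf{a}) \text{ for all } \mathbf{a} \in \mathbb{F}^n, \lambda \in \mathbb{F}\}$. The map $\pi_{\operatorname{rad}(P)} \colon \mathbb{F}^n \to \mathbb{F}^n/\operatorname{rad}(P)$ is the canonical projection, and $P_{\operatorname{rad}(P)} \colon \mathbb{F}^n/\operatorname{rad}(P) \to \mathbb{F}$ is the unique function such that $P = P_{\operatorname{rad}(P)} \circ \pi_{\operatorname{rad}(P)}$ (it has trivial radical). A map $T$ preserves a function $f$ if $f\circ T = f$. The maps $\phi,\psi$ are not assumed linear, surjective or continuous. *)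

theory Defs
  imports
    "HOL-Analysis.Cartesian_Space"
    "HOL-Library.Poly_Mapping"
    "HOL-Library.Set_Algebras"
    "HOL-Library.FuncSet"
begin

text \<open>
  A polynomial over \<open>'a\<close> in the indeterminates \<open>x\<^sub>i\<close>, \<open>i :: 'n\<close>, is a finitely supported map from
  monomials to coefficients; a monomial is the finitely supported map of its exponents.
\<close>

type_synonym ('n, 'a) mpolynomial = "('n \<Rightarrow>\<^sub>0 nat) \<Rightarrow>\<^sub>0 'a"

definition homogeneous :: "nat \<Rightarrow> ('n::finite, 'a::zero) mpolynomial \<Rightarrow> bool" where
  "homogeneous d P \<longleftrightarrow>
     (\<forall>m\<in>Poly_Mapping.keys P. (\<Sum>i\<in>UNIV. Poly_Mapping.lookup m i) = d)"

definition poly_fun :: "('n::finite, 'a::comm_semiring_1) mpolynomial \<Rightarrow> 'a ^ 'n \<Rightarrow> 'a" where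
  "poly_fun P x = (\<Sum>m\<in>Poly_Mapping.keys P.
     Poly_Mapping.lookup P m * (\<Prod>i\<in>UNIV. (x $ i) ^ Poly_Mapping.lookup m i))"

definition rad :: "('n::finite, 'a::comm_semiring_1) mpolynomial \<Rightarrow> ('a ^ 'n) set" where
  "rad P = {x. \<forall>a l. poly_fun P (a + l *s x) = poly_fun P a}"

lemma subspace_rad: "vec.subspace (rad P)"
  for P :: "('n::finite, 'a::field) mpolynomial"
proof (rule vec.subspaceI)
  show "0 \<in> rad P" by (simp add: rad_def)
next
  fix x y assume "x \<in> rad P" "y \<in> rad P"
  then show "x + y \<in> rad P"
    by (simp add: rad_def vector_add_ldistrib flip: add.assoc)
next
  fix c x assume "x \<in> rad P"
  then show "c *s x \<in> rad P"
    by (simp add: rad_def vector_smult_assoc)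
qed

text \<open>
  The quotient of \<open>'a ^ 'n\<close> by a subspace \<open>W\<close> is the set of cosets of \<open>W\<close>. Cosets are added by
  the elementwise sum of sets. The summand \<open>W\<close> in \<open>quot_scale\<close> is needed for the scalar \<open>0\<close>,
  whose elementwise multiple of a coset is \<open>{0}\<close> and not \<open>W\<close>.
\<close>

definition proj :: "('a::field ^ 'n) set \<Rightarrow> 'a ^ 'n \<Rightarrow> ('a ^ 'n) set" where
  "proj W x = x +o W"

definition quot :: "('a::field ^ 'n) set \<Rightarrow> ('a ^ 'n) set set" where
  "quot W = range (proj W)"

definition quot_scale :: "('a::field ^ 'n) set \<Rightarrow> 'a \<Rightarrow> ('a ^ 'n) set \<Rightarrow> ('a ^ 'n) set" where
  "quot_scale W c A = ((*s) c ` A) + W"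

lemma proj_eq_iff:
  assumes "vec.subspace W"
  shows "proj W x = proj W y \<longleftrightarrow> x - y \<in> W"
proof
  assume "proj W x = proj W y"
  moreover have "x \<in> proj W x"
    using vec.subspace_0[OF assms] by (force simp: proj_def elt_set_plus_def)
  ultimately show "x - y \<in> W"
    by (auto simp: proj_def elt_set_plus_def)
next
  assume d: "x - y \<in> W"
  have "proj W u \<subseteq> proj W v" if uv: "u - v \<in> W" for u v
  proof
    fix z assume "z \<in> proj W u"
    then obtain w where w: "w \<in> W" "z = u + w" by (auto simp: proj_def elt_set_plus_def)
    have "(u - v) + w \<in> W" using assms uv w(1) by (rule vec.subspace_add)
    moreover have "z = v + ((u - v) + w)" using w(2) by simp
    ultimately show "z \<in> proj W v" unfolding proj_def elt_set_plus_def by blast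
  qed
  moreover have "y - x \<in> W" using vec.subspace_neg[OF assms d] by simp
  ultimately show "proj W x = proj W y" using d by blast
qed

lemma proj_add:
  assumes "vec.subspace W"
  shows "proj W x + proj W y = proj W (x + y)"
proof -
  have "W + W = W"
  proof
    show "W + W \<subseteq> W" using vec.subspace_add[OF assms] by (auto simp: set_plus_def)
    show "W \<subseteq> W + W" using vec.subspace_0[OF assms] by (force simp: set_plus_def)
  qed
  then show ?thesis by (simp add: proj_def set_plus_rearrange)
qed

lemma quot_scale_proj:
  assumes "vec.subspace W"
  shows "quot_scale W c (proj W x) = proj W (c *s x)"
proof
  show "quot_scale W c (proj W x) \<subseteq> proj W (c *s x)"
  proof
    fix z assume "z \<in> quot_scale W c (proj W x)"
    then obtain v w where vw: "v \<in> W" "w \<in> W" "z = c *s (x + v) + w"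
      by (auto simp: quot_scale_def proj_def elt_set_plus_def set_plus_def)
    have "c *s v + w \<in> W"
      using assms vec.subspace_scale[OF assms vw(1)] vw(2) by (rule vec.subspace_add)
    moreover have "z = c *s x + (c *s v + w)"
      using vw(3) by (simp add: vector_add_ldistrib add.assoc)
    ultimately show "z \<in> proj W (c *s x)" unfolding proj_def elt_set_plus_def by blast
  qed
  have "x \<in> proj W x"
    using vec.subspace_0[OF assms] by (force simp: proj_def elt_set_plus_def)
  then show "proj W (c *s x) \<subseteq> quot_scale W c (proj W x)"
    by (auto simp: quot_scale_def proj_def[of W "c *s x"] elt_set_plus_def set_plus_def)
qed

text \<open>
  Linear maps of the quotient to itself. They are extensional, that is, undefined outside the
  quotient, so that equality of such maps is equality on the quotient.
\<close>

definition quot_linear :: "('a::field ^ 'n) set \<Rightarrow> (('a ^ 'n) set \<Rightarrow> ('a ^ 'n) set) \<Rightarrow> bool" where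
  "quot_linear W T \<longleftrightarrow>
     T \<in> quot W \<rightarrow>\<^sub>E quot W \<and>
     (\<forall>A\<in>quot W. \<forall>B\<in>quot W. T (A + B) = T A + T B) \<and>
     (\<forall>c. \<forall>A\<in>quot W. T (quot_scale W c A) = quot_scale W c (T A))"

text \<open>
  The function on the quotient by the radical that is induced by \<open>P\<close>: its value on a coset is the
  only value that \<open>P\<close> takes there.
\<close>

definition rad_fun :: "('n::finite, 'a::field) mpolynomial \<Rightarrow> ('a ^ 'n) set \<Rightarrow> 'a" where
  "rad_fun P A = the_elem (poly_fun P ` A)"

lemma rad_fun_proj: "rad_fun P (proj (rad P) x) = poly_fun P x"
proof -
  have "poly_fun P (x + w) = poly_fun P x" if "w \<in> rad P" for w
    using that unfolding rad_def by (metis (mono_tags, lifting) mem_Collect_eq vector_smult_lid)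
  then have "poly_fun P ` proj (rad P) x = {poly_fun P x}"
    using vec.subspace_0[OF subspace_rad[of P]]
    by (force simp: proj_def elt_set_plus_def)
  then show ?thesis by (simp add: rad_fun_def)
qed

lemma rad_fun_unique:
  assumes "f \<circ> proj (rad P) = poly_fun P" and "A \<in> quot (rad P)"
  shows "f A = rad_fun P A"
  using assms by (auto simp: quot_def rad_fun_proj fun_eq_iff)

end

theory Submission
  imports Defs "HOL-Computational_Algebra.Polynomial"
begin

text \<open>
  Comparing the coefficients of \<open>\<lambda>\<close> in the hypothesis gives
  \<open>\<nabla>P(x) \<bullet> y = \<nabla>P(\<phi> x) \<bullet> \<psi> y\<close>, and in characteristic \<open>0\<close> the radical is the set of vectors
  orthogonal to all gradients. This factorization of the pairing shows that the gradients at the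
  points \<open>\<phi> x\<close> span as large a space as all gradients do, so a vector orthogonal to the former is
  already in the radical. Hence \<open>\<psi>\<close> is linear modulo the radical. By homogeneity the hypothesis is
  symmetric in \<open>\<phi>\<close> and \<open>\<psi>\<close>, so \<open>\<phi>\<close> is linear modulo the radical too; as it preserves \<open>P\<close>, also
  \<open>\<nabla>P(x) \<bullet> y = \<nabla>P(\<phi> x) \<bullet> \<phi> y\<close>, and therefore \<open>\<phi> y - \<psi> y\<close> lies in the radical.
\<close>

section \<open>The dot product and spans\<close>

definition dot :: "'a::comm_semiring_1 ^ 'n::finite \<Rightarrow> 'a ^ 'n \<Rightarrow> 'a" where
  "dot u v = (\<Sum>i\<in>UNIV. u $ i * v $ i)"

lemma dot_add_left: "dot (u + v) w = dot u w + dot v w"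
  and dot_add_right: "dot w (u + v) = dot w u + dot w v"
  and dot_scale_left: "dot (c *s u) w = c * dot u w"
  and dot_scale_right: "dot w (c *s u) = c * dot w u"
  by (simp_all add: dot_def algebra_simps sum.distrib sum_distrib_left)

lemma dot_diff_right: "dot w (u - v) = dot w u - dot w v"
  for w :: "'a::comm_ring_1 ^ 'n::finite"
  by (simp add: dot_def algebra_simps sum_subtractf)

lemma dot_zero_left [simp]: "dot 0 w = 0"
  by (simp add: dot_def)

lemma dot_sum_left: "dot (sum f A) w = (\<Sum>a\<in>A. dot (f a) w)"
  by (induction A rule: infinite_finite_induct) (simp_all add: dot_add_left)

lemma dot_left_ext:
  assumes "\<And>w. dot u w = dot v w"
  shows "u = v"
proof -
  have "dot x (axis i 1) = x $ i" for x :: "'a ^ 'n" and i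
    by (simp add: dot_def axis_def if_distrib cong: if_cong)
  then show ?thesis using assms by (metis vec_eq_iff)
qed

lemma dot_eq_0_span:
  assumes "\<And>u. u \<in> S \<Longrightarrow> dot u v = 0" and "g \<in> vec.span S"
  shows "dot g v = 0"
  using assms(2)
  by (induction rule: vec.span_induct_alt) (simp_all add: assms(1) dot_add_left dot_scale_left)

text \<open>By \<open>fact\<close>, a linear relation between values of \<open>g\<close> at points
  \<open>\<phi> z\<close> holds with the same coefficients between the values at the points
  \<open>z\<close> themselves. So \<open>g\<close> has no larger rank than
  \<open>g \<circ> \<phi>\<close>.\<close>

lemma span_range_comp_eq:
  fixes g :: "'b \<Rightarrow> 'a::field ^ 'n::finite"
  assumes fact: "\<And>x y. dot (g x) y = dot (g (\<phi> x)) (\<psi> y)"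
  shows "vec.span (range (g \<circ> \<phi>)) = vec.span (range g)"
proof -
  obtain C where C: "C \<subseteq> range (g \<circ> \<phi>)" "vec.independent C" "range (g \<circ> \<phi>) \<subseteq> vec.span C"
      "card C = vec.dim (range (g \<circ> \<phi>))"
    using vec.basis_exists by blast
  have fin: "finite C" using C(2) vec.finiteI_independent by blast
  have "\<forall>c\<in>C. \<exists>x. g (\<phi> x) = c" using C(1) by auto
  then obtain x where x: "\<forall>c\<in>C. g (\<phi> (x c)) = c"
    by (rule bchoice[THEN exE])
  have "g z \<in> vec.span ((g \<circ> x) ` C)" for z
  proof -
    have "g (\<phi> z) \<in> vec.span C" using C(3) by auto
    then obtain u where u: "g (\<phi> z) = (\<Sum>c\<in>C. u c *s c)"
      unfolding vec.span_finite[OF fin] by auto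
    have "g z = (\<Sum>c\<in>C. u c *s g (x c))"
    proof (rule dot_left_ext)
      fix w
      have "dot (g z) w = (\<Sum>c\<in>C. u c * dot c (\<psi> w))"
        by (simp add: fact[of z] u dot_sum_left dot_scale_left)
      also have "\<dots> = (\<Sum>c\<in>C. u c * dot (g (x c)) w)"
      proof (intro sum.cong refl)
        fix c assume "c \<in> C"
        then show "u c * dot c (\<psi> w) = u c * dot (g (x c)) w"
          by (simp only: fact[of "x c" w] bspec[OF x])
      qed
      finally show "dot (g z) w = dot (\<Sum>c\<in>C. u c *s g (x c)) w"
        by (simp add: dot_sum_left dot_scale_left)
    qed
    then show ?thesis
      by (auto intro!: vec.span_sum vec.span_scale intro: vec.span_base)
  qed
  \<comment> \<open>The \<open>card C\<close> vectors \<open>g (x c)\<close> span the range of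
    \<open>g\<close>. This bounds the dimension; the inclusion of spans is trivial, so equality
    follows.\<close>
  then have "vec.dim (range g) \<le> card ((g \<circ> x) ` C)"
    using fin by (intro vec.dim_le_card) auto
  also have "\<dots> \<le> vec.dim (range (g \<circ> \<phi>))"
    using card_image_le[OF fin] C(4) by metis
  finally have "vec.dim (vec.span (range g)) \<le> vec.dim (vec.span (range (g \<circ> \<phi>)))"
    by simp
  then show ?thesis
    by (intro vec.subspace_dim_equal vec.span_mono) auto
qed

section \<open>Gradients and restrictions to lines\<close>

text \<open>The formal gradient. Where the exponent is 0, the truncated subtraction is harmless, as
  the factor \<open>of_nat 0\<close> kills the term.\<close>

definition grad :: "('n::finite, 'a::comm_semiring_1) mpolynomial \<Rightarrow> 'a ^ 'n \<Rightarrow> 'a ^ 'n" where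
  "grad P x = (\<chi> i. \<Sum>m\<in>Poly_Mapping.keys P. Poly_Mapping.lookup P m *
     (of_nat (Poly_Mapping.lookup m i) * (x $ i) ^ (Poly_Mapping.lookup m i - 1) *
      (\<Prod>j\<in>UNIV - {i}. (x $ j) ^ Poly_Mapping.lookup m j)))"

text \<open>Restricting to a line gives a univariate polynomial in the parameter, for which
  \<open>pderiv\<close> and root counting are available.\<close>

definition line_poly ::
    "('n::finite, 'a::comm_ring_1) mpolynomial \<Rightarrow> 'a ^ 'n \<Rightarrow> 'a ^ 'n \<Rightarrow> 'a poly" where
  "line_poly P x y = (\<Sum>m\<in>Poly_Mapping.keys P.
     smult (Poly_Mapping.lookup P m) (\<Prod>i\<in>UNIV. [:x $ i, y $ i:] ^ Poly_Mapping.lookup m i))"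

lemma poly_line_poly: "poly (line_poly P x y) l = poly_fun P (x + l *s y)"
  by (simp add: line_poly_def poly_fun_def poly_sum poly_prod)

text \<open>The chain rule along a line, by the product rule on each monomial.\<close>

lemma poly_pderiv_line_poly:
  fixes P :: "('n::finite, 'a::idom) mpolynomial"
  shows "poly (pderiv (line_poly P x y)) l = dot (grad P (x + l *s y)) y"
proof -
  have "poly (pderiv (\<Prod>i\<in>UNIV. [:x $ i, y $ i:] ^ Poly_Mapping.lookup m i)) l =
     (\<Sum>i\<in>UNIV. (of_nat (Poly_Mapping.lookup m i) *
       ((x + l *s y) $ i) ^ (Poly_Mapping.lookup m i - 1) *
       (\<Prod>j\<in>UNIV - {i}. ((x + l *s y) $ j) ^ Poly_Mapping.lookup m j)) * y $ i)"
    for m :: "'n \<Rightarrow>\<^sub>0 nat"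
    by (simp add: pderiv_prod pderiv_power poly_sum poly_prod pderiv_pCons algebra_simps)
  then have "poly (pderiv (line_poly P x y)) l =
     (\<Sum>m\<in>Poly_Mapping.keys P. \<Sum>i\<in>UNIV. Poly_Mapping.lookup P m * (of_nat (Poly_Mapping.lookup m i) *
       ((x + l *s y) $ i) ^ (Poly_Mapping.lookup m i - 1) *
       (\<Prod>j\<in>UNIV - {i}. ((x + l *s y) $ j) ^ Poly_Mapping.lookup m j)) * y $ i)"
    by (simp add: line_poly_def higher_pderiv_sum[of 1, simplified] pderiv_smult poly_sum
        sum_distrib_left mult.assoc)
  also have "\<dots> = dot (grad P (x + l *s y)) y"
    unfolding dot_def grad_def by (subst sum.swap) (simp add: sum_distrib_right)
  finally show ?thesis .
qed

text \<open>Otherwise the nonzero difference would have infinitely many roots. The point 0 is left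
  out because \<open>homogeneous_swap\<close> inverts the parameter.\<close>

lemma poly_eq_if_eq_on_nonzero:
  fixes p q :: "'a::field_char_0 poly"
  assumes "\<And>l. l \<noteq> 0 \<Longrightarrow> poly p l = poly q l"
  shows "p = q"
proof (rule ccontr)
  assume "p \<noteq> q"
  then have "finite {l. poly (p - q) l = 0}" by (intro poly_roots_finite) simp
  moreover have "UNIV \<subseteq> insert 0 {l. poly (p - q) l = 0}" using assms by auto
  ultimately have "finite (UNIV :: 'a set)" using finite_subset by blast
  then show False using infinite_UNIV_char_0 by blast
qed

lemma dot_grad_cong:
  fixes P :: "('n::finite, 'a::field_char_0) mpolynomial"
  assumes "\<And>l. poly_fun P (x + l *s y) = poly_fun P (u + l *s v)"
  shows "dot (grad P x) y = dot (grad P u) v"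
proof -
  have "line_poly P x y = line_poly P u v"
    by (rule poly_eq_if_eq_on_nonzero) (simp add: poly_line_poly assms)
  then show ?thesis
    using poly_pderiv_line_poly[of P x y 0] poly_pderiv_line_poly[of P u v 0] by simp
qed

lemma rad_eq_grad_orthogonal:
  fixes P :: "('n::finite, 'a::field_char_0) mpolynomial"
  shows "rad P = {v. \<forall>a. dot (grad P a) v = 0}"
proof (intro set_eqI iffI CollectI allI)
  fix v a assume "v \<in> rad P"
  \<comment> \<open>Along the direction \<open>v\<close> the values are those along the direction
    0.\<close>
  then have "dot (grad P a) v = dot (grad P a) 0"
    by (intro dot_grad_cong) (simp add: rad_def)
  then show "dot (grad P a) v = 0" by (simp add: dot_def)
next
  fix v assume v: "v \<in> {v. \<forall>a. dot (grad P a) v = 0}"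
  have "poly_fun P (a + l *s v) = poly_fun P a" for a l
  proof -
    have "pderiv (line_poly P a v) = 0"
      using v by (intro poly_eq_if_eq_on_nonzero) (simp add: poly_pderiv_line_poly)
    \<comment> \<open>In characteristic 0 a vanishing derivative forces a constant.\<close>
    then obtain c where "line_poly P a v = [:c:]"
      using pderiv_iszero by blast
    then have "poly (line_poly P a v) l = poly (line_poly P a v) 0" by simp
    then show ?thesis by (simp add: poly_line_poly)
  qed
  then show "v \<in> rad P" by (simp add: rad_def)
qed

section \<open>Homogeneity\<close>

lemma poly_fun_scale:
  assumes "homogeneous d P"
  shows "poly_fun P (c *s x) = c ^ d * poly_fun P x"
proof -
  have "(\<Prod>i\<in>UNIV. ((c *s x) $ i) ^ Poly_Mapping.lookup m i) =
      c ^ d * (\<Prod>i\<in>UNIV. (x $ i) ^ Poly_Mapping.lookup m i)"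
    if "m \<in> Poly_Mapping.keys P" for m
    using assms that
    by (simp add: homogeneous_def power_mult_distrib prod.distrib flip: power_sum)
  then show ?thesis
    by (simp add: poly_fun_def sum_distrib_left mult_ac cong: sum.cong)
qed

text \<open>For \<open>k \<noteq> 0\<close>, \<open>y + k *s x\<close> is \<open>k\<close> times
  \<open>x + inverse k *s y\<close>, so \<open>eq\<close> at \<open>inverse k\<close> gives the
  claim at \<open>k\<close>. The case of parameter 0 follows since both sides are polynomials in
  it.\<close>

lemma homogeneous_swap:
  fixes P :: "('n::finite, 'a::field_char_0) mpolynomial"
  assumes hom: "homogeneous d P"
    and eq: "\<And>l. poly_fun P (x + l *s y) = poly_fun P (u + l *s v)"
  shows "poly_fun P (y + l *s x) = poly_fun P (v + l *s u)"
proof -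
  have rev: "poly_fun P (b + k *s a) = k ^ d * poly_fun P (a + inverse k *s b)" if "k \<noteq> 0" for a b k
  proof -
    have "b + k *s a = k *s (a + inverse k *s b)"
      using that by (simp add: vector_add_ldistrib vector_smult_assoc)
    then show ?thesis by (simp only: poly_fun_scale[OF hom])
  qed
  have "line_poly P y x = line_poly P v u"
  proof (rule poly_eq_if_eq_on_nonzero)
    fix k :: 'a assume "k \<noteq> 0"
    show "poly (line_poly P y x) k = poly (line_poly P v u) k"
      unfolding poly_line_poly rev[OF \<open>k \<noteq> 0\<close>, of y x] rev[OF \<open>k \<noteq> 0\<close>, of v u] eq ..
  qed
  then show ?thesis by (metis poly_line_poly)
qed

section \<open>Linearity modulo the radical\<close>

text \<open>The last three claims follow from the first: paired with
  \<open>grad P (\<phi> x)\<close>, the vector \<open>\<psi> y\<close> gives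
  \<open>dot (grad P x) y\<close>, which is linear in \<open>y\<close> and vanishes on the
  radical.\<close>

lemma linear_mod_rad:
  fixes P :: "('n::finite, 'a::field_char_0) mpolynomial"
  assumes eq: "\<And>x y l. poly_fun P (x + l *s y) = poly_fun P (\<phi> x + l *s \<psi> y)"
  shows mem_rad_if_orthogonal: "(\<And>x. dot (grad P (\<phi> x)) v = 0) \<Longrightarrow> v \<in> rad P"
    and add_mod_rad: "\<psi> (y + z) - (\<psi> y + \<psi> z) \<in> rad P"
    and scale_mod_rad: "\<psi> (c *s y) - c *s \<psi> y \<in> rad P"
    and cong_mod_rad: "y - z \<in> rad P \<Longrightarrow> \<psi> y - \<psi> z \<in> rad P"
proof -
  have pair: "dot (grad P x) y = dot (grad P (\<phi> x)) (\<psi> y)" for x y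
    using eq by (rule dot_grad_cong)
  show orth: "v \<in> rad P" if v: "\<And>x. dot (grad P (\<phi> x)) v = 0" for v
  proof -
    have "dot (grad P a) v = 0" for a
    proof (rule dot_eq_0_span)
      show "grad P a \<in> vec.span (range (grad P \<circ> \<phi>))"
        unfolding span_range_comp_eq[of "grad P" \<phi> \<psi>, OF pair] by (simp add: vec.span_base)
    qed (use v in auto)
    then show ?thesis by (simp add: rad_eq_grad_orthogonal)
  qed
  show "\<psi> (y + z) - (\<psi> y + \<psi> z) \<in> rad P"
    by (rule orth) (simp add: dot_diff_right dot_add_right flip: pair)
  show "\<psi> (c *s y) - c *s \<psi> y \<in> rad P"
    by (rule orth) (simp add: dot_diff_right dot_scale_right flip: pair)
  show "\<psi> y - \<psi> z \<in> rad P" if "y - z \<in> rad P"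
  proof (rule orth)
    fix x
    have "dot (grad P x) (y - z) = 0" using that by (simp add: rad_eq_grad_orthogonal)
    then show "dot (grad P (\<phi> x)) (\<psi> y - \<psi> z) = 0"
      by (simp add: dot_diff_right flip: pair)
  qed
qed

lemma poly_fun_cong_rad: "x - y \<in> rad P \<Longrightarrow> poly_fun P x = poly_fun P y"
  for P :: "('n::finite, 'a::field) mpolynomial"
  using proj_eq_iff[OF subspace_rad[of P], of x y] rad_fun_proj[of P x] rad_fun_proj[of P y] by simp

lemma diff_mem_rad:
  fixes P :: "('n::finite, 'a::field_char_0) mpolynomial"
  assumes hom: "homogeneous d P"
    and eq: "\<And>x y l. poly_fun P (x + l *s y) = poly_fun P (\<phi> x + l *s \<psi> y)"
  shows "\<phi> y - \<psi> y \<in> rad P"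
proof (rule mem_rad_if_orthogonal[OF eq])
  fix x
  have swap: "poly_fun P (x + l *s y) = poly_fun P (\<psi> x + l *s \<phi> y)" for x y l
    using hom eq by (rule homogeneous_swap)
  have "poly_fun P (x + l *s y) = poly_fun P (\<phi> x + l *s \<phi> y)" for l
  proof -
    \<comment> \<open>The sum telescopes to
      \<open>\<phi> (x + l *s y) - (\<phi> x + l *s \<phi> y)\<close>; \<open>swap\<close> lets the
      linearity results speak about \<open>\<phi>\<close>.\<close>
    have "(\<phi> (x + l *s y) - (\<phi> x + \<phi> (l *s y))) + (\<phi> (l *s y) - l *s \<phi> y) \<in> rad P"
      using add_mod_rad[OF swap] scale_mod_rad[OF swap]
      by (rule vec.subspace_add[OF subspace_rad])
    then have "poly_fun P (\<phi> (x + l *s y)) = poly_fun P (\<phi> x + l *s \<phi> y)"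
      by (intro poly_fun_cong_rad) (simp add: algebra_simps)
    \<comment> \<open>The scalar 0 in \<open>eq\<close> shows that \<open>\<phi>\<close> preserves
      \<open>P\<close>.\<close>
    then show ?thesis using eq[of "x + l *s y" 0] by simp
  qed
  then have "dot (grad P x) y = dot (grad P (\<phi> x)) (\<phi> y)"
    by (rule dot_grad_cong)
  moreover have "dot (grad P x) y = dot (grad P (\<phi> x)) (\<psi> y)"
    using eq by (rule dot_grad_cong)
  ultimately show "dot (grad P (\<phi> x)) (\<phi> y - \<psi> y) = 0"
    by (simp add: dot_diff_right)
qed

theorem theorem1p2:
  fixes P :: "('n::finite, 'a::field_char_0) mpolynomial"
    and \<phi> \<psi> :: "'a ^ 'n \<Rightarrow> 'a ^ 'n"
    and d :: nat
  assumes "homogeneous d P"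
    and "\<And>x y l. poly_fun P (x + l *s y) = poly_fun P (\<phi> x + l *s \<psi> y)"
  shows "\<exists>!T. quot_linear (rad P) T \<and>
           (\<forall>A\<in>quot (rad P). rad_fun P (T A) = rad_fun P A) \<and>
           proj (rad P) \<circ> \<phi> = proj (rad P) \<circ> \<psi> \<and>
           proj (rad P) \<circ> \<psi> = T \<circ> proj (rad P)"
proof -
  let ?W = "rad P"
  note W = subspace_rad[of P]
  have swap: "poly_fun P (x + l *s y) = poly_fun P (\<psi> x + l *s \<phi> y)" for x y l
    using assms by (rule homogeneous_swap)
  \<comment> \<open>\<open>inv\<close> picks a representative of each coset;
    \<open>cong_mod_rad\<close> makes the choice irrelevant. The restricted abstraction makes
    \<open>T\<close> extensional.\<close>
  define T where "T = (\<lambda>A\<in>quot ?W. proj ?W (\<psi> (inv (proj ?W) A)))"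
  have T: "T (proj ?W x) = proj ?W (\<psi> x)" for x
  proof -
    have "proj ?W (inv (proj ?W) (proj ?W x)) = proj ?W x"
      by (simp add: f_inv_into_f)
    then have "proj ?W (\<psi> (inv (proj ?W) (proj ?W x))) = proj ?W (\<psi> x)"
      using cong_mod_rad[OF assms(2)] by (simp add: proj_eq_iff[OF W])
    then show ?thesis by (simp add: T_def quot_def)
  qed
  have "quot_linear ?W T"
    unfolding quot_linear_def
  proof (intro conjI ballI allI)
    show "T \<in> quot ?W \<rightarrow>\<^sub>E quot ?W"
      by (auto simp: T_def quot_def)
    fix A assume "A \<in> quot ?W"
    then obtain x where x: "A = proj ?W x" by (auto simp: quot_def)
    show "T (A + B) = T A + T B" if "B \<in> quot ?W" for B
    proof -
      obtain y where y: "B = proj ?W y" using \<open>B \<in> quot ?W\<close> by (auto simp: quot_def)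
      show ?thesis
        using add_mod_rad[OF assms(2)]
        by (simp add: x y T proj_add[OF W] proj_eq_iff[OF W])
    qed
    show "T (quot_scale ?W c A) = quot_scale ?W c (T A)" for c
      using scale_mod_rad[OF assms(2)]
      by (simp add: x T quot_scale_proj[OF W] proj_eq_iff[OF W])
  qed
  moreover have "rad_fun P (T A) = rad_fun P A" if "A \<in> quot ?W" for A
    \<comment> \<open>The scalar 0 in \<open>swap\<close> shows that \<open>\<psi>\<close>, which
      induces \<open>T\<close>, preserves \<open>P\<close>.\<close>
    using that swap[of _ 0] by (auto simp: quot_def T rad_fun_proj)
  moreover have "proj ?W \<circ> \<phi> = proj ?W \<circ> \<psi>"
    using diff_mem_rad[OF assms] by (simp add: fun_eq_iff proj_eq_iff[OF W])
  moreover have "proj ?W \<circ> \<psi> = T \<circ> proj ?W"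
    by (simp add: fun_eq_iff T)
  \<comment> \<open>Every element of the quotient is a projection, so the composite with
    \<open>proj ?W\<close> determines \<open>S\<close> there; extensionality settles the
    rest.\<close>
  moreover have "S = T" if "quot_linear ?W S" "proj ?W \<circ> \<psi> = S \<circ> proj ?W" for S
  proof (rule PiE_ext)
    show "S \<in> quot ?W \<rightarrow>\<^sub>E quot ?W" "T \<in> quot ?W \<rightarrow>\<^sub>E quot ?W"
      using that(1) \<open>quot_linear ?W T\<close> by (simp_all add: quot_linear_def)
    show "S A = T A" if "A \<in> quot ?W" for A
      using that \<open>proj ?W \<circ> \<psi> = S \<circ> proj ?W\<close> by (auto simp: quot_def T fun_eq_iff)
  qed
  ultimately show ?thesis by (intro ex1I[of _ T] conjI ballI) blast+
qed

end
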